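(* Let $\psi(x,t)\ge0$ satisfy the nonlinear problem $$\frac{\partial \psi}{\partial t} = D\frac{\partial^2\psi}{\partial x^2}+f(\psi) \quad\text{in } 0<x<L(t),\qquad \psi(0,t)=\psi(L(t),t)=0,$$ where $f$ is of KPP type, i.e. $f$ is Lipschitz continuous, differentiable at $0$, and satisfies $$f(0)=f(1)=0,\qquad f'(0)>0,\qquad \frac{f(k)}{k}\ \text{non-increasing on } k>0.$$ Assume that (i) $\dot L(t)L(t)$ is bounded below on $t\ge0$; (ii) $\displaystyle\int_0^T\left(\frac{D\pi^2}{L(t)^2}-\frac{D\pi^2}{L_{crit}^2}-\frac{L(t)[\ddot L(t)]^+}{4D}+\frac{\dot L(t)}{2L(t)}\right)dt\to\infty$ as $T\to\infty$. Then $\psi(x,t)$ converges uniformly (in $x$) to zero as $t\to\infty$.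
   Context: Here $D>0$ is a constant and $L_{crit}=\pi\sqrt{D/f'(0)}$. The function $L(t)$ is a prescribed twice continuously differentiable function of $t\ge0$ with $L(t)>0$ for all $t\ge0$; dots denote derivatives with respect to $t$. Solutions $\psi$ are non-negative, and the problem is posed for $t\ge0$. For any function $F(t)$, $[F(t)]^+\ge0$ and $[F(t)]^-\ge0$ denote its positive and negative parts, so that $F(t)\equiv[F(t)]^+-[F(t)]^-$. *)

theory Defs
  imports "HOL-Analysis.Analysis"
begin

text \<open>Solutions are non-negative, so only the values of \<open>f\<close> on \<open>[0, \<infinity>)\<close> matter; accordingly
  \<open>f'(0)\<close>, which is the parameter \<open>f'0\<close>, is a one-sided derivative.\<close>

definition kpp_type :: "(real \<Rightarrow> real) \<Rightarrow> real \<Rightarrow> bool" where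
  "kpp_type f f'0 \<longleftrightarrow>
     (\<exists>C. C-lipschitz_on {0..} f) \<and>
     (f has_real_derivative f'0) (at 0 within {0..}) \<and>
     f 0 = 0 \<and> f 1 = 0 \<and> f'0 > 0 \<and>
     antimono_on {0<..} (\<lambda>k. f k / k)"

definition L_crit :: "real \<Rightarrow> real \<Rightarrow> real" where
  "L_crit D f'0 = pi * sqrt (D / f'0)"

definition C2_length :: "(real \<Rightarrow> real) \<Rightarrow> (real \<Rightarrow> real) \<Rightarrow> (real \<Rightarrow> real) \<Rightarrow> bool" where
  "C2_length L L' L'' \<longleftrightarrow>
     (\<forall>t\<ge>0. L t > 0 \<and>
       (L has_real_derivative L' t) (at t within {0..}) \<and>
       (L' has_real_derivative L'' t) (at t within {0..})) \<and>
     continuous_on {0..} L''"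

text \<open>The solution \<open>\<psi> x t\<close> is classical: jointly continuous up to the lateral boundary, with the
  derivatives appearing in the equation existing pointwise in the interior. No continuity is required
  at \<open>t = 0\<close>, so initial data that are discontinuous or incompatible with the boundary
  conditions are admitted. Values of \<open>\<psi>\<close> outside \<open>0 \<le> x \<le> L t\<close>, \<open>t \<ge> 0\<close> are irrelevant.\<close>

definition nonneg_solution ::
  "real \<Rightarrow> (real \<Rightarrow> real) \<Rightarrow> (real \<Rightarrow> real) \<Rightarrow> (real \<Rightarrow> real \<Rightarrow> real) \<Rightarrow> bool" where
  "nonneg_solution D f L \<psi> \<longleftrightarrow>
     (\<forall>t\<ge>0. \<forall>x\<in>{0..L t}. \<psi> x t \<ge> 0) \<and>
     (\<forall>t\<ge>0. \<psi> 0 t = 0 \<and> \<psi> (L t) t = 0) \<and>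
     continuous_on {(x, t). t > 0 \<and> 0 \<le> x \<and> x \<le> L t} (\<lambda>(x, t). \<psi> x t) \<and>
     (\<exists>\<psi>\<^sub>x \<psi>\<^sub>x\<^sub>x \<psi>\<^sub>t. \<forall>t>0. \<forall>x\<in>{0<..<L t}.
        ((\<lambda>y. \<psi> y t) has_real_derivative \<psi>\<^sub>x x t) (at x) \<and>
        ((\<lambda>y. \<psi>\<^sub>x y t) has_real_derivative \<psi>\<^sub>x\<^sub>x x t) (at x) \<and>
        ((\<lambda>s. \<psi> x s) has_real_derivative \<psi>\<^sub>t x t) (at t) \<and>
        \<psi>\<^sub>t x t = D * \<psi>\<^sub>x\<^sub>x x t + f (\<psi> x t))"

text \<open>The library's \<open>uniform_limit\<close> is over a fixed set, whereas here the interval moves with \<open>t\<close>.\<close>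

definition uniformly_to_zero :: "(real \<Rightarrow> real) \<Rightarrow> (real \<Rightarrow> real \<Rightarrow> real) \<Rightarrow> bool" where
  "uniformly_to_zero L \<psi> \<longleftrightarrow>
     (\<forall>\<epsilon>>0. \<forall>\<^sub>F t in at_top. \<forall>x\<in>{0..L t}. \<bar>\<psi> x t\<bar> < \<epsilon>)"

end

theory Submission
  imports Defs
begin

text \<open>The KPP condition gives \<open>f k \<le> f'(0) k\<close>, so \<open>\<psi>\<close> is a subsolution of the linear equation
  \<open>u\<^sub>t = D u\<^sub>x\<^sub>x + f'(0) u\<close>, and it suffices to bound it by a supersolution that tends to zero.
  The change of variables \<open>y = x / L(t)\<close> produces a first-order term, which the factor
  \<open>exp (- L' x\<^sup>2 / (4 D L))\<close> removes: for
  \<open>u = exp (g(t) - L' x\<^sup>2 / (4 D L)) v(x / L)\<close> one finds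
  \<open>u\<^sub>t - D u\<^sub>x\<^sub>x = exp (g - L' x\<^sup>2 / (4 D L)) ((g' + L' / (2 L) - L'' x\<^sup>2 / (4 D L)) v - D v'' / L\<^sup>2)\<close>
  (lemma \<open>profile_parabolic_residual\<close>). Take \<open>v y = sin (\<pi> y)\<close> and \<open>g'\<close> equal to minus the
  integrand of the integral condition, in which \<open>D \<pi>\<^sup>2 / L\<^sub>c\<^sub>r\<^sub>i\<^sub>t\<^sup>2 = f'(0)\<close>. Since \<open>0 \<le> x \<le> L\<close>, the term \<open>L'' x\<^sup>2 / (4 D L)\<close> is at most
  \<open>L [L'']\<^sup>+ / (4 D)\<close>, and \<open>u\<close> is a supersolution. The integral condition says
  \<open>g \<rightarrow> -\<infinity>\<close>, and the lower bound on \<open>L' L\<close> bounds \<open>exp (- L' x\<^sup>2 / (4 D L))\<close>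
  above, so \<open>u \<rightarrow> 0\<close> uniformly.

  The comparison \<open>\<psi> \<le> K u\<close> (lemma \<open>comparison_principle\<close>) has to start from a time at which
  \<open>\<psi>\<close> is bounded by a multiple of \<open>sin (\<pi> x / L)\<close>. As \<open>\<psi>\<close> is only continuous up to
  the lateral boundary, this linear vanishing is itself obtained by comparison with another
  supersolution of the same form (lemma \<open>solution_le_sine\<close>).\<close>

section \<open>The parabolic maximum principle on a moving interval\<close>

text \<open>The closed space-time region between times \<open>a\<close> and \<open>b\<close>, as a set of pairs \<open>(x, t)\<close>.\<close>

definition moving_region :: "(real \<Rightarrow> real) \<Rightarrow> real \<Rightarrow> real \<Rightarrow> (real \<times> real) set" where
  "moving_region L a b = {(x, t). a \<le> t \<and> t \<le> b \<and> 0 \<le> x \<and> x \<le> L t}"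

lemma compact_moving_region:
  assumes "continuous_on {a..b} L" "\<And>t. t \<in> {a..b} \<Longrightarrow> L t > 0"
  shows "compact (moving_region L a b)"
proof -
  have "moving_region L a b = (\<lambda>(\<xi>, t). (\<xi> * L t, t)) ` ({0..1} \<times> {a..b})" (is "_ = ?h ` ?R")
  proof
    show "moving_region L a b \<subseteq> ?h ` ?R"
    proof
      fix p assume p: "p \<in> moving_region L a b"
      obtain x t where xt: "p = (x, t)" by (cases p)
      have "L t > 0" using p assms(2) by (auto simp: moving_region_def xt)
      then have "p = ?h (x / L t, t)" "(x / L t, t) \<in> ?R"
        using p by (auto simp: moving_region_def xt)
      then show "p \<in> ?h ` ?R" by blast
    qed
    show "?h ` ?R \<subseteq> moving_region L a b"
      using assms(2) by (auto simp: moving_region_def mult_left_le_one_le less_imp_le)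
  qed
  moreover have "continuous_on ?R ?h"
    unfolding case_prod_beta
    by (intro continuous_intros continuous_on_compose2[OF assms(1)]) auto
  ultimately show ?thesis
    by (simp add: compact_continuous_image compact_Times)
qed

lemma second_derivative_nonpos_at_max:
  fixes u u1 :: "real \<Rightarrow> real"
  assumes "x \<in> {a<..<b}"
    and d1: "\<And>y. y \<in> {a<..<b} \<Longrightarrow> (u has_real_derivative u1 y) (at y)"
    and d2: "(u1 has_real_derivative u2) (at x)"
    and max: "\<And>y. y \<in> {a<..<b} \<Longrightarrow> u y \<le> u x"
  shows "u2 \<le> 0"
proof (rule ccontr)
  assume "\<not> u2 \<le> 0"
  have "u1 x = 0"
  proof (rule DERIV_local_max[OF d1[OF assms(1)]])
    show "0 < min (x - a) (b - x)" using assms(1) by simp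
    show "\<forall>y. \<bar>x - y\<bar> < min (x - a) (b - x) \<longrightarrow> u y \<le> u x" by (auto intro!: max)
  qed
  with DERIV_pos_inc_right[OF d2] \<open>\<not> u2 \<le> 0\<close>
  obtain d where d: "d > 0" "\<And>h. 0 < h \<Longrightarrow> h < d \<Longrightarrow> u1 (x + h) > 0" by auto
  define h where "h = min d (b - x) / 2"
  have h: "0 < h" "h < d" "x + h < b" using d(1) assms(1) by (auto simp: h_def min_def field_simps)
  have "u x < u (x + h)"
  proof (rule DERIV_pos_imp_increasing_open[where f = u])
    show "x < x + h" using h by simp
    fix y assume y: "x < y" "y < x + h"
    have "u1 y > 0" using d(2)[of "y - x"] y h by simp
    moreover have "(u has_real_derivative u1 y) (at y)" using y h assms(1) by (intro d1) auto
    ultimately show "\<exists>z. (u has_real_derivative z) (at y) \<and> 0 < z" by blast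
  next
    show "continuous_on {x..x + h} u"
      using h assms(1) by (intro continuous_at_imp_continuous_on ballI DERIV_isCont[OF d1]) auto
  qed
  moreover have "u (x + h) \<le> u x" using h assms(1) by (intro max) auto
  ultimately show False by simp
qed

text \<open>Only the separate partial derivatives of \<open>w\<close> are assumed, so the argument is carried out in
  the original coordinates: straightening the moving interval would require joint differentiability.
  The derivatives are needed at the final time \<open>b\<close> as well, but not at \<open>a\<close>.\<close>

lemma parabolic_maximum_principle:
  fixes w w\<^sub>x w\<^sub>x\<^sub>x w\<^sub>t :: "real \<Rightarrow> real \<Rightarrow> real"
  assumes "D \<ge> 0"
    and L: "continuous_on {a..b} L" "\<And>t. t \<in> {a..b} \<Longrightarrow> L t > 0"
    and cont: "continuous_on (moving_region L a b) (\<lambda>(x, t). w x t)"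
    and dx: "\<And>x t. a < t \<Longrightarrow> t \<le> b \<Longrightarrow> 0 < x \<Longrightarrow> x < L t \<Longrightarrow>
      ((\<lambda>y. w y t) has_real_derivative w\<^sub>x x t) (at x)"
    and dxx: "\<And>x t. a < t \<Longrightarrow> t \<le> b \<Longrightarrow> 0 < x \<Longrightarrow> x < L t \<Longrightarrow>
      ((\<lambda>y. w\<^sub>x y t) has_real_derivative w\<^sub>x\<^sub>x x t) (at x)"
    and dt: "\<And>x t. a < t \<Longrightarrow> t \<le> b \<Longrightarrow> 0 < x \<Longrightarrow> x < L t \<Longrightarrow>
      ((\<lambda>s. w x s) has_real_derivative w\<^sub>t x t) (at t)"
    and ineq: "\<And>x t. a < t \<Longrightarrow> t \<le> b \<Longrightarrow> 0 < x \<Longrightarrow> x < L t \<Longrightarrow>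
      w\<^sub>t x t \<le> D * w\<^sub>x\<^sub>x x t + c * w x t"
    and init: "\<And>x. 0 \<le> x \<Longrightarrow> x \<le> L a \<Longrightarrow> w x a \<le> 0"
    and lateral: "\<And>t. t \<in> {a..b} \<Longrightarrow> w 0 t \<le> 0 \<and> w (L t) t \<le> 0"
    and xt: "a \<le> t" "t \<le> b" "0 \<le> x" "x \<le> L t"
  shows "w x t \<le> 0"
proof (rule ccontr)
  assume pos: "\<not> w x t \<le> 0"
  \<comment> \<open>the exponential weight makes the inequality strict at a positive maximum\<close>
  define z where "z x t = exp (- (c + 1) * t) * w x t" for x t
  have "continuous_on (moving_region L a b) (\<lambda>p. z (fst p) (snd p))"
    using cont unfolding z_def case_prod_beta by (intro continuous_intros)
  moreover have inQ: "(x, t) \<in> moving_region L a b" using xt by (simp add: moving_region_def)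
  ultimately obtain p where p: "p \<in> moving_region L a b"
      "\<And>q. q \<in> moving_region L a b \<Longrightarrow> z (fst q) (snd q) \<le> z (fst p) (snd p)"
    using continuous_attains_sup[OF compact_moving_region[OF L], of "\<lambda>p. z (fst p) (snd p)"] by blast
  obtain x0 t0 where p0: "p = (x0, t0)" by (cases p)
  have Q0: "a \<le> t0" "t0 \<le> b" "0 \<le> x0" "x0 \<le> L t0"
    using p(1) by (auto simp: p0 moving_region_def)
  have zmax: "z y s \<le> z x0 t0" if "a \<le> s" "s \<le> b" "0 \<le> y" "y \<le> L s" for y s
    using p(2)[of "(y, s)"] that by (simp add: p0 moving_region_def)
  have "z x t > 0" using pos by (simp add: z_def)
  with zmax[OF xt] have "z x0 t0 > 0" by simp
  then have w0: "w x0 t0 > 0" by (simp add: z_def zero_less_mult_iff)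
  have int: "a < t0" "0 < x0" "x0 < L t0"
    using w0 Q0 init[of x0] lateral[of t0]
    by (auto simp: order.strict_iff_order)
  have xx: "w\<^sub>x\<^sub>x x0 t0 \<le> 0"
  proof (rule second_derivative_nonpos_at_max[where a = 0 and b = "L t0"])
    show "x0 \<in> {0<..<L t0}" using int by simp
    show "((\<lambda>y. w\<^sub>x y t0) has_real_derivative w\<^sub>x\<^sub>x x0 t0) (at x0)" using int Q0 by (intro dxx) auto
    fix y assume y: "y \<in> {0<..<L t0}"
    show "((\<lambda>y. w y t0) has_real_derivative w\<^sub>x y t0) (at y)" using int Q0 y by (intro dx) auto
    show "w y t0 \<le> w x0 t0" using zmax[of t0 y] y Q0 by (simp add: z_def)
  qed
  define zt where "zt = exp (- (c + 1) * t0) * (w\<^sub>t x0 t0 - (c + 1) * w x0 t0)"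
  have zt: "((\<lambda>s. z x0 s) has_real_derivative zt) (at t0)"
    unfolding z_def zt_def
    by (rule derivative_eq_intros dt int Q0 refl)+ (simp add: algebra_simps)
  have "zt \<ge> 0"
  proof (rule ccontr)
    assume "\<not> zt \<ge> 0"
    with DERIV_neg_dec_left[OF zt] obtain d
      where d: "d > 0" "\<And>h. 0 < h \<Longrightarrow> h < d \<Longrightarrow> z x0 t0 < z x0 (t0 - h)" by auto
    \<comment> \<open>earlier times close to \<open>t0\<close> still see \<open>x0\<close> inside the moving interval\<close>
    have "(L \<longlongrightarrow> L t0) (at t0 within {a..b})"
      using L(1) Q0 by (auto simp: continuous_on_def)
    then have "\<forall>\<^sub>F s in at t0 within {a..b}. L s > x0"
      using int(3) by (rule order_tendstoD)
    then obtain e where e: "e > 0" "\<And>s. s \<in> {a..b} \<Longrightarrow> s \<noteq> t0 \<Longrightarrow> dist s t0 < e \<Longrightarrow> L s > x0"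
      by (auto simp: eventually_at)
    define h where "h = min (min d e) (t0 - a) / 2"
    have h: "0 < h" "h < d" "h < e" "h < t0 - a"
      using d(1) e(1) int(1) by (auto simp: h_def min_def)
    have "L (t0 - h) > x0" using h Q0 by (intro e(2)) (auto simp: dist_real_def)
    then have "z x0 (t0 - h) \<le> z x0 t0" using h Q0 by (intro zmax) auto
    with d(2)[OF h(1,2)] show False by simp
  qed
  then have "w\<^sub>t x0 t0 \<ge> (c + 1) * w x0 t0" by (simp add: zt_def zero_le_mult_iff)
  moreover have "w\<^sub>t x0 t0 \<le> D * w\<^sub>x\<^sub>x x0 t0 + c * w x0 t0" using int Q0 by (intro ineq) auto
  moreover have "D * w\<^sub>x\<^sub>x x0 t0 \<le> 0" using \<open>D \<ge> 0\<close> xx by (simp add: mult_nonneg_nonpos)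
  ultimately show False using w0 by (simp add: algebra_simps)
qed

section \<open>Comparison with supersolutions of the linearised equation\<close>

lemma kpp_type_le_linear:
  assumes "kpp_type f f'0" "k \<ge> 0"
  shows "f k \<le> f'0 * k"
proof (cases "k = 0")
  case True
  then show ?thesis using assms by (simp add: kpp_type_def)
next
  case False
  with assms have k: "k > 0" by simp
  have "(f has_real_derivative f'0) (at 0 within {0..})" using assms(1) by (simp add: kpp_type_def)
  then have "((\<lambda>h. (f h - f 0) / (h - 0)) \<longlongrightarrow> f'0) (at 0 within {0..})"
    by (simp add: has_field_derivative_iff)
  moreover have "f 0 = 0" using assms(1) by (simp add: kpp_type_def)
  ultimately have "((\<lambda>h. f h / h) \<longlongrightarrow> f'0) (at 0 within {0..})" by simp
  then have lim: "((\<lambda>h. f h / h) \<longlongrightarrow> f'0) (at_right 0)"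
    by (rule tendsto_within_subset) auto
  have "\<forall>\<^sub>F h in at_right 0. h < k" 
    using k by (auto simp: eventually_at_right_field)
  moreover have "\<forall>\<^sub>F h :: real in at_right 0. h > 0" by (rule eventually_at_right_less)
  ultimately have "\<forall>\<^sub>F h in at_right 0. f k / k \<le> f h / h"
  proof eventually_elim
    case (elim h)
    have "antimono_on {0<..} (\<lambda>k. f k / k)" using assms(1) by (simp add: kpp_type_def)
    then show ?case using elim by (auto dest!: monotone_onD[where x = h and y = k])
  qed
  then have "f k / k \<le> f'0" by (intro tendsto_lowerbound[OF lim]) auto
  with k show ?thesis by (simp add: field_simps)
qed

lemma C2_lengthD:
  assumes "C2_length L L' L''"
  shows "t \<ge> 0 \<Longrightarrow> L t > 0"
    and "t > 0 \<Longrightarrow> (L has_real_derivative L' t) (at t)"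
    and "t > 0 \<Longrightarrow> (L' has_real_derivative L'' t) (at t)"
    and "continuous_on {0..} L" "continuous_on {0..} L'" "continuous_on {0..} L''"
proof -
  have d: "(L has_real_derivative L' t) (at t within {0..})"
      "(L' has_real_derivative L'' t) (at t within {0..})" if "t \<ge> 0" for t
    using assms that by (auto simp: C2_length_def)
  have at: "at t within {0..} = at t" if "t > 0" for t :: real
    by (rule at_within_interior) (use that in simp)
  show "t \<ge> 0 \<Longrightarrow> L t > 0" "continuous_on {0..} L''"
    using assms by (auto simp: C2_length_def)
  show "continuous_on {0..} L" "continuous_on {0..} L'"
    using d by (auto intro!: DERIV_continuous_on)
  show "t > 0 \<Longrightarrow> (L has_real_derivative L' t) (at t)"
    "t > 0 \<Longrightarrow> (L' has_real_derivative L'' t) (at t)"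
    using d[of t] at[of t] by auto
qed

text \<open>Supersolutions of \<open>u\<^sub>t = D u\<^sub>x\<^sub>x + c u\<close>. The regularity asked for is that of
  \<open>nonneg_solution\<close>: continuity on the closed region, and pointwise partial derivatives inside it,
  up to and including the final time.\<close>

definition linear_supersolution ::
  "real \<Rightarrow> real \<Rightarrow> (real \<Rightarrow> real) \<Rightarrow> real \<Rightarrow> real \<Rightarrow> (real \<Rightarrow> real \<Rightarrow> real) \<Rightarrow> bool" where
  "linear_supersolution D c L a b h \<longleftrightarrow>
     continuous_on (moving_region L a b) (\<lambda>(x, t). h x t) \<and>
     (\<exists>h\<^sub>x h\<^sub>x\<^sub>x h\<^sub>t. \<forall>t x. a < t \<longrightarrow> t \<le> b \<longrightarrow> 0 < x \<longrightarrow> x < L t \<longrightarrow>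
        ((\<lambda>y. h y t) has_real_derivative h\<^sub>x x t) (at x) \<and>
        ((\<lambda>y. h\<^sub>x y t) has_real_derivative h\<^sub>x\<^sub>x x t) (at x) \<and>
        ((\<lambda>s. h x s) has_real_derivative h\<^sub>t x t) (at t) \<and>
        h\<^sub>t x t \<ge> D * h\<^sub>x\<^sub>x x t + c * h x t)"

text \<open>By \<open>kpp_type_le_linear\<close> the difference \<open>\<psi> - h\<close> satisfies the inequality of the
  maximum principle with rate \<open>c\<close>, the derivative of \<open>f\<close> at zero.\<close>

lemma comparison_principle:
  assumes "D > 0" "kpp_type f c" "C2_length L L' L''" "nonneg_solution D f L \<psi>"
    and h: "linear_supersolution D c L a b h" and "0 < a"
    and init: "\<And>x. 0 \<le> x \<Longrightarrow> x \<le> L a \<Longrightarrow> \<psi> x a \<le> h x a"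
    and lateral: "\<And>t. t \<in> {a..b} \<Longrightarrow> 0 \<le> h 0 t \<and> 0 \<le> h (L t) t"
    and xt: "a \<le> t" "t \<le> b" "0 \<le> x" "x \<le> L t"
  shows "\<psi> x t \<le> h x t"
proof -
  obtain h\<^sub>x h\<^sub>x\<^sub>x h\<^sub>t where hd: "\<And>t x. a < t \<Longrightarrow> t \<le> b \<Longrightarrow> 0 < x \<Longrightarrow> x < L t \<Longrightarrow>
      ((\<lambda>y. h y t) has_real_derivative h\<^sub>x x t) (at x) \<and>
      ((\<lambda>y. h\<^sub>x y t) has_real_derivative h\<^sub>x\<^sub>x x t) (at x) \<and>
      ((\<lambda>s. h x s) has_real_derivative h\<^sub>t x t) (at t) \<and>
      h\<^sub>t x t \<ge> D * h\<^sub>x\<^sub>x x t + c * h x t"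
    using h unfolding linear_supersolution_def by blast
  obtain \<psi>\<^sub>x \<psi>\<^sub>x\<^sub>x \<psi>\<^sub>t where pd: "\<forall>t>0. \<forall>x\<in>{0<..<L t}.
        ((\<lambda>y. \<psi> y t) has_real_derivative \<psi>\<^sub>x x t) (at x) \<and>
        ((\<lambda>y. \<psi>\<^sub>x y t) has_real_derivative \<psi>\<^sub>x\<^sub>x x t) (at x) \<and>
        ((\<lambda>s. \<psi> x s) has_real_derivative \<psi>\<^sub>t x t) (at t) \<and>
        \<psi>\<^sub>t x t = D * \<psi>\<^sub>x\<^sub>x x t + f (\<psi> x t)"
    using assms(4) unfolding nonneg_solution_def by blast
  have \<psi>: "\<psi> 0 t = 0" "\<psi> (L t) t = 0" "0 \<le> x \<Longrightarrow> x \<le> L t \<Longrightarrow> \<psi> x t \<ge> 0" if "t \<ge> 0" for x t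
    using assms(4) that by (auto simp: nonneg_solution_def)
  have "\<psi> x t - h x t \<le> 0"
  proof (rule parabolic_maximum_principle[where D = D and L = L and a = a and b = b and c = c
        and x = x and t = t and w = "\<lambda>x t. \<psi> x t - h x t"
        and w\<^sub>x = "\<lambda>x t. \<psi>\<^sub>x x t - h\<^sub>x x t" and w\<^sub>x\<^sub>x = "\<lambda>x t. \<psi>\<^sub>x\<^sub>x x t - h\<^sub>x\<^sub>x x t"
        and w\<^sub>t = "\<lambda>x t. \<psi>\<^sub>t x t - h\<^sub>t x t"])
    show "continuous_on {a..b} L"
      using C2_lengthD(4)[OF assms(3)] \<open>0 < a\<close> by (auto elim: continuous_on_subset)
    show "L t > 0" if "t \<in> {a..b}" for t
      using C2_lengthD(1)[OF assms(3), of t] \<open>0 < a\<close> that by auto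
    have "continuous_on (moving_region L a b) (\<lambda>(x, t). \<psi> x t)"
      by (rule continuous_on_subset[where s = "{(x, t). t > 0 \<and> 0 \<le> x \<and> x \<le> L t}"])
        (use assms(4) \<open>0 < a\<close> in \<open>auto simp: nonneg_solution_def moving_region_def\<close>)
    moreover have "continuous_on (moving_region L a b) (\<lambda>(x, t). h x t)"
      using h by (simp add: linear_supersolution_def)
    ultimately show "continuous_on (moving_region L a b) (\<lambda>(x, t). \<psi> x t - h x t)"
      unfolding case_prod_beta by (rule continuous_on_diff)
  next
    fix x t assume *: "a < t" "t \<le> b" "0 < x" "x < L t"
    then have p: "((\<lambda>y. \<psi> y t) has_real_derivative \<psi>\<^sub>x x t) (at x)"
        "((\<lambda>y. \<psi>\<^sub>x y t) has_real_derivative \<psi>\<^sub>x\<^sub>x x t) (at x)"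
        "((\<lambda>s. \<psi> x s) has_real_derivative \<psi>\<^sub>t x t) (at t)"
        "\<psi>\<^sub>t x t = D * \<psi>\<^sub>x\<^sub>x x t + f (\<psi> x t)"
      using pd \<open>0 < a\<close> by (metis dual_order.strict_trans greaterThanLessThan_iff)+
    show "((\<lambda>y. \<psi> y t - h y t) has_real_derivative \<psi>\<^sub>x x t - h\<^sub>x x t) (at x)"
      "((\<lambda>y. \<psi>\<^sub>x y t - h\<^sub>x y t) has_real_derivative \<psi>\<^sub>x\<^sub>x x t - h\<^sub>x\<^sub>x x t) (at x)"
      "((\<lambda>s. \<psi> x s - h x s) has_real_derivative \<psi>\<^sub>t x t - h\<^sub>t x t) (at t)"
      using p hd[OF *] by (auto intro: DERIV_diff)
    have "f (\<psi> x t) \<le> c * \<psi> x t"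
      using kpp_type_le_linear[OF assms(2)] \<psi>(3)[of t x] * \<open>0 < a\<close> by auto
    then show "\<psi>\<^sub>t x t - h\<^sub>t x t \<le> D * (\<psi>\<^sub>x\<^sub>x x t - h\<^sub>x\<^sub>x x t) + c * (\<psi> x t - h x t)"
      using p(4) hd[OF *] by (simp add: algebra_simps)
  next
    show "\<psi> x a - h x a \<le> 0" if "0 \<le> x" "x \<le> L a" for x
      using init that by simp
    show "\<psi> 0 t - h 0 t \<le> 0 \<and> \<psi> (L t) t - h (L t) t \<le> 0" if "t \<in> {a..b}" for t
      using lateral[OF that] \<psi>[of t] \<open>0 < a\<close> that by auto
  qed (use assms(1) xt in auto)
  then show ?thesis by simp
qed

section \<open>Profiles on the moving interval\<close>

text \<open>A function \<open>v\<close> of the rescaled variable \<open>x / L t\<close>, with the Gaussian factor that cancels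
  the transport term caused by the motion of the boundary, and an amplitude \<open>exp (g t)\<close>.\<close>

definition profile ::
  "real \<Rightarrow> (real \<Rightarrow> real) \<Rightarrow> (real \<Rightarrow> real) \<Rightarrow> (real \<Rightarrow> real) \<Rightarrow> (real \<Rightarrow> real) \<Rightarrow> real \<Rightarrow> real \<Rightarrow> real" where
  "profile D L L' g v x t = exp (g t - L' t * x\<^sup>2 / (4 * D * L t)) * v (x / L t)"

lemma profile_derivatives:
  fixes v v' v'' :: "real \<Rightarrow> real"
  assumes "D > 0" "C2_length L L' L''" "t > 0"
    and v: "\<And>y. (v has_real_derivative v' y) (at y)" "\<And>y. (v' has_real_derivative v'' y) (at y)"
    and g: "(g has_real_derivative g') (at t)"
  defines "E \<equiv> \<lambda>x. exp (g t - L' t * x\<^sup>2 / (4 * D * L t))"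
  shows profile_x: "((\<lambda>x. profile D L L' g v x t) has_real_derivative
      E x * (v' (x / L t) / L t - L' t * x / (2 * D * L t) * v (x / L t))) (at x)"
    and profile_xx: "((\<lambda>x. E x * (v' (x / L t) / L t - L' t * x / (2 * D * L t) * v (x / L t)))
      has_real_derivative
      E x * (v'' (x / L t) / (L t)\<^sup>2 - L' t * x / (D * (L t)\<^sup>2) * v' (x / L t)
        + ((L' t * x / (2 * D * L t))\<^sup>2 - L' t / (2 * D * L t)) * v (x / L t))) (at x)"
    and profile_t: "((\<lambda>t. profile D L L' g v x t) has_real_derivative
      E x * ((g' - x\<^sup>2 / (4 * D) * (L'' t * L t - (L' t)\<^sup>2) / (L t)\<^sup>2) * v (x / L t)
        - x * L' t / (L t)\<^sup>2 * v' (x / L t))) (at t)"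
proof -
  have L: "L t > 0" "(L has_real_derivative L' t) (at t)" "(L' has_real_derivative L'' t) (at t)"
    using C2_lengthD[OF assms(2)] assms(3) by auto
  note nz = L(1)[THEN less_imp_neq, symmetric] assms(1)[THEN less_imp_neq, symmetric]
  have vx: "((\<lambda>x. v (x / L t)) has_real_derivative v' (x / L t) * (1 / L t)) (at x)"
    "((\<lambda>x. v' (x / L t)) has_real_derivative v'' (x / L t) * (1 / L t)) (at x)"
    by (rule DERIV_chain2[OF v(1)] DERIV_chain2[OF v(2)]; (rule derivative_eq_intros refl)+; simp add: nz)+
  have Ex: "(E has_real_derivative E x * (- L' t * x / (2 * D * L t))) (at x)"
    unfolding E_def
    by (rule DERIV_cong, (rule derivative_intros)+) (use nz in \<open>simp_all add: field_simps\<close>)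
  show 1: "((\<lambda>x. profile D L L' g v x t) has_real_derivative
      E x * (v' (x / L t) / L t - L' t * x / (2 * D * L t) * v (x / L t))) (at x)"
    unfolding profile_def
    by (rule DERIV_cong[OF DERIV_mult[OF Ex[unfolded E_def] vx(1)]])
      (use nz in \<open>simp add: E_def field_simps\<close>)
  have Bx: "((\<lambda>x. v' (x / L t) / L t - L' t * x / (2 * D * L t) * v (x / L t)) has_real_derivative
      v'' (x / L t) / (L t)\<^sup>2 - (L' t / (2 * D * L t) * v (x / L t)
        + L' t * x / (2 * D * L t) * (v' (x / L t) / L t))) (at x)"
    by (rule DERIV_cong, (rule DERIV_diff DERIV_mult DERIV_cdivide DERIV_cmult DERIV_ident vx)+)
      (use nz in \<open>simp add: power2_eq_square field_simps\<close>)
  show "((\<lambda>x. E x * (v' (x / L t) / L t - L' t * x / (2 * D * L t) * v (x / L t)))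
      has_real_derivative
      E x * (v'' (x / L t) / (L t)\<^sup>2 - L' t * x / (D * (L t)\<^sup>2) * v' (x / L t)
        + ((L' t * x / (2 * D * L t))\<^sup>2 - L' t / (2 * D * L t)) * v (x / L t))) (at x)"
    by (rule DERIV_cong[OF DERIV_mult[OF Ex Bx]])
      (use nz in \<open>simp add: divide_simps power2_eq_square; simp add: algebra_simps\<close>)
  have vt: "((\<lambda>t. v (x / L t)) has_real_derivative v' (x / L t) * (- x * L' t / (L t)\<^sup>2)) (at t)"
    by (rule DERIV_chain2[OF v(1)], (rule derivative_eq_intros L refl)+)
      (simp_all add: nz power2_eq_square)
  have Et: "((\<lambda>t. exp (g t - L' t * x\<^sup>2 / (4 * D * L t))) has_real_derivative
      E x * (g' - x\<^sup>2 / (4 * D) * (L'' t * L t - (L' t)\<^sup>2) / (L t)\<^sup>2)) (at t)"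
    unfolding E_def
  proof (rule DERIV_cong)
    show "((\<lambda>t. exp (g t - L' t * x\<^sup>2 / (4 * D * L t))) has_real_derivative
      exp (g t - L' t * x\<^sup>2 / (4 * D * L t)) *
        (g' - (L'' t * x\<^sup>2 * (4 * D * L t) - L' t * x\<^sup>2 * (4 * D * L' t))
          / (4 * D * L t * (4 * D * L t)))) (at t)"
      using nz by (intro DERIV_fun_exp DERIV_diff DERIV_divide DERIV_cmult_right DERIV_cmult g L) auto
    have "(L'' t * x\<^sup>2 * (4 * D * L t) - L' t * x\<^sup>2 * (4 * D * L' t)) / (4 * D * L t * (4 * D * L t))
        = x\<^sup>2 / (4 * D) * (L'' t * L t - (L' t)\<^sup>2) / (L t)\<^sup>2"
      using nz by (simp add: divide_simps power2_eq_square) (simp add: algebra_simps)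
    then show "exp (g t - L' t * x\<^sup>2 / (4 * D * L t)) *
        (g' - (L'' t * x\<^sup>2 * (4 * D * L t) - L' t * x\<^sup>2 * (4 * D * L' t))
          / (4 * D * L t * (4 * D * L t)))
        = exp (g t - L' t * x\<^sup>2 / (4 * D * L t)) *
        (g' - x\<^sup>2 / (4 * D) * (L'' t * L t - (L' t)\<^sup>2) / (L t)\<^sup>2)"
      by simp
  qed
  show "((\<lambda>t. profile D L L' g v x t) has_real_derivative
      E x * ((g' - x\<^sup>2 / (4 * D) * (L'' t * L t - (L' t)\<^sup>2) / (L t)\<^sup>2) * v (x / L t)
        - x * L' t / (L t)\<^sup>2 * v' (x / L t))) (at t)"
    unfolding profile_def
    by (rule DERIV_cong[OF DERIV_mult[OF Et vt]]) (simp add: E_def field_simps)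
qed


lemma profile_parabolic_residual:
  fixes v v' v'' :: "real \<Rightarrow> real"
  assumes "D > 0" "C2_length L L' L''"
    and "\<And>y. (v has_real_derivative v' y) (at y)" "\<And>y. (v' has_real_derivative v'' y) (at y)"
    and "\<And>t. t > 0 \<Longrightarrow> (g has_real_derivative g' t) (at t)"
  shows "\<exists>h\<^sub>x h\<^sub>x\<^sub>x h\<^sub>t. \<forall>t>0. \<forall>x.
     ((\<lambda>y. profile D L L' g v y t) has_real_derivative h\<^sub>x x t) (at x) \<and>
     ((\<lambda>y. h\<^sub>x y t) has_real_derivative h\<^sub>x\<^sub>x x t) (at x) \<and>
     ((\<lambda>s. profile D L L' g v x s) has_real_derivative h\<^sub>t x t) (at t) \<and>
     h\<^sub>t x t - D * h\<^sub>x\<^sub>x x t = exp (g t - L' t * x\<^sup>2 / (4 * D * L t)) *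
       ((g' t + L' t / (2 * L t) - L'' t * x\<^sup>2 / (4 * D * L t)) * v (x / L t)
         - D * v'' (x / L t) / (L t)\<^sup>2)"
proof (intro exI allI impI conjI)
  fix t x :: real assume "t > 0"
  note d = profile_derivatives[OF assms(1,2) \<open>t > 0\<close> assms(3,4) assms(5)[OF \<open>t > 0\<close>]]
  show "((\<lambda>y. profile D L L' g v y t) has_real_derivative
      (\<lambda>x t. exp (g t - L' t * x\<^sup>2 / (4 * D * L t)) *
        (v' (x / L t) / L t - L' t * x / (2 * D * L t) * v (x / L t))) x t) (at x)"
    using d(1) by simp
  show "((\<lambda>y. (\<lambda>x t. exp (g t - L' t * x\<^sup>2 / (4 * D * L t)) *
        (v' (x / L t) / L t - L' t * x / (2 * D * L t) * v (x / L t))) y t) has_real_derivative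
      (\<lambda>x t. exp (g t - L' t * x\<^sup>2 / (4 * D * L t)) *
      (v'' (x / L t) / (L t)\<^sup>2 - L' t * x / (D * (L t)\<^sup>2) * v' (x / L t)
        + ((L' t * x / (2 * D * L t))\<^sup>2 - L' t / (2 * D * L t)) * v (x / L t))) x t) (at x)"
    using d(2) by simp
  show "((\<lambda>s. profile D L L' g v x s) has_real_derivative
      (\<lambda>x t. exp (g t - L' t * x\<^sup>2 / (4 * D * L t)) *
      ((g' t - x\<^sup>2 / (4 * D) * (L'' t * L t - (L' t)\<^sup>2) / (L t)\<^sup>2) * v (x / L t)
        - x * L' t / (L t)\<^sup>2 * v' (x / L t))) x t) (at t)"
    using d(3) by simp
  have nz: "L t \<noteq> 0" "D \<noteq> 0" using C2_lengthD(1)[OF assms(2), of t] \<open>t > 0\<close> assms(1) by auto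
  have "(g' t - x\<^sup>2 / (4 * D) * (L'' t * L t - (L' t)\<^sup>2) / (L t)\<^sup>2) * v (x / L t)
        - x * L' t / (L t)\<^sup>2 * v' (x / L t)
      - D * (v'' (x / L t) / (L t)\<^sup>2 - L' t * x / (D * (L t)\<^sup>2) * v' (x / L t)
        + ((L' t * x / (2 * D * L t))\<^sup>2 - L' t / (2 * D * L t)) * v (x / L t))
      = (g' t + L' t / (2 * L t) - L'' t * x\<^sup>2 / (4 * D * L t)) * v (x / L t)
         - D * v'' (x / L t) / (L t)\<^sup>2"
    using nz by (simp add: divide_simps power2_eq_square) (simp add: algebra_simps)
  moreover have "E * A - D * (E * B) = E * (A - D * B)" for E A B :: real
    by (simp add: algebra_simps)
  ultimately show "(\<lambda>x t. exp (g t - L' t * x\<^sup>2 / (4 * D * L t)) *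
      ((g' t - x\<^sup>2 / (4 * D) * (L'' t * L t - (L' t)\<^sup>2) / (L t)\<^sup>2) * v (x / L t)
        - x * L' t / (L t)\<^sup>2 * v' (x / L t))) x t
      - D * (\<lambda>x t. exp (g t - L' t * x\<^sup>2 / (4 * D * L t)) *
      (v'' (x / L t) / (L t)\<^sup>2 - L' t * x / (D * (L t)\<^sup>2) * v' (x / L t)
        + ((L' t * x / (2 * D * L t))\<^sup>2 - L' t / (2 * D * L t)) * v (x / L t))) x t
     = exp (g t - L' t * x\<^sup>2 / (4 * D * L t)) *
       ((g' t + L' t / (2 * L t) - L'' t * x\<^sup>2 / (4 * D * L t)) * v (x / L t)
         - D * v'' (x / L t) / (L t)\<^sup>2)"
    by simp
qed

lemma continuous_on_profile:
  assumes "D > 0" "C2_length L L' L''" "0 \<le> a" "continuous_on {a..b} g" "continuous_on UNIV v"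
  shows "continuous_on (moving_region L a b) (\<lambda>(x, t). profile D L L' g v x t)"
proof -
  have pos: "L (snd p) > 0" if "p \<in> moving_region L a b" for p
    using that assms(3) C2_lengthD(1)[OF assms(2)] by (auto simp: moving_region_def)
  have c: "continuous_on (moving_region L a b) (\<lambda>p. F (snd p))"
    if "continuous_on {a..b} F" for F :: "real \<Rightarrow> real"
    by (rule continuous_on_compose2[OF that]) (auto simp: moving_region_def intro: continuous_intros)
  have "continuous_on {a..b} L" "continuous_on {a..b} L'"
    using C2_lengthD(4,5)[OF assms(2)] assms(3) by (auto elim: continuous_on_subset)
  note c[OF this(1)] c[OF this(2)] c[OF assms(4)]
  moreover from this have "continuous_on (moving_region L a b) (\<lambda>p. v (fst p / L (snd p)))"
    by (intro continuous_on_compose2[OF assms(5)] continuous_intros) (auto dest: pos)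
  ultimately show ?thesis
    unfolding profile_def case_prod_beta using assms(1)
    by (intro continuous_intros) (auto dest: pos)
qed

section \<open>Linear vanishing of solutions at the boundary\<close>

lemma primitive_has_derivative:
  fixes F :: "real \<Rightarrow> real"
  assumes "continuous_on {0..} F" "t > 0"
  shows "((\<lambda>T. integral {0..T} F) has_real_derivative F t) (at t)"
proof -
  have "continuous_on {0..t + 1} F" using assms(1) by (rule continuous_on_subset) auto
  then have "((\<lambda>T. integral {0..T} F) has_real_derivative F t) (at t within {0..t + 1})"
    using assms(2) by (intro integral_has_real_derivative) auto
  then show ?thesis using assms(2) by (simp add: at_within_Icc_at)
qed

text \<open>This is where the positive part of \<open>L''\<close> comes from: only the upper bound matters, and where
  \<open>L''\<close> is negative the worst case is \<open>x = 0\<close>.\<close>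

lemma growth_term_bound:
  fixes l x d :: real
  assumes "D > 0" "0 \<le> x" "x \<le> l" "l > 0"
  shows "d * x\<^sup>2 / (4 * D * l) \<le> l * max 0 d / (4 * D)"
proof -
  have "d * x\<^sup>2 \<le> max 0 d * l\<^sup>2"
    using assms by (intro mult_mono power_mono) auto
  then have "d * x\<^sup>2 / (4 * D * l) \<le> max 0 d * l\<^sup>2 / (4 * D * l)"
    using assms by (intro divide_right_mono) auto
  also have "\<dots> = l * max 0 d / (4 * D)"
    using assms by (simp add: power2_eq_square field_simps)
  finally show ?thesis .
qed

lemma sin_pi_times_nonneg:
  fixes y :: real
  assumes "0 \<le> y" "y \<le> 1"
  shows "0 \<le> sin (pi * y)"
proof -
  have "pi * y \<le> pi * 1" using assms by (intro mult_left_mono) auto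
  then show ?thesis using assms by (simp add: sin_ge_zero)
qed

text \<open>A supersolution with profile \<open>sin (\<pi> y)\<close> vanishes linearly at both ends, so it dominates
  \<open>\<psi>\<close> at a given time only if \<open>\<psi>\<close> does the same; a merely continuous function need not. The
  parabolic equation provides this one unit of time later. The barrier is a multiple of a profile
  with \<open>v = 3 S - S\<^sup>2\<close>, \<open>S = sin (\<pi> y)\<close>, plus a term that is large at the initial time \<open>a\<close> and
  zero at time \<open>b\<close>. The point of this \<open>v\<close> is that \<open>v'' \<le> - \<pi>\<^sup>2\<close> holds up to the boundary
  of the interval, so the profile is a strict supersolution, uniformly on a compact region, and can
  absorb the time derivative of the second term.\<close>

lemma solution_le_sine:
  assumes "D > 0" "kpp_type f c" "C2_length L L' L''" "nonneg_solution D f L \<psi>" "0 < a"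
  defines "b \<equiv> a + 1"
  shows "\<exists>K\<ge>0. \<forall>x\<in>{0..L b}. \<psi> x b \<le> K * profile D L L' (\<lambda>_. 0) (\<lambda>y. sin (pi * y)) x b"
proof -
  note L = C2_lengthD[OF assms(3)]
  have "c > 0" using assms(2) by (simp add: kpp_type_def)
  define r where "r t = L' t / (2 * L t) - L t * max 0 (L'' t) / (4 * D)" for t
  define g where "g T = integral {0..T} (\<lambda>t. c - r t)" for T
  have "continuous_on {0..} (\<lambda>t. c - r t)"
    unfolding r_def using L(4-6) L(1) assms(1)
    by (intro continuous_intros continuous_on_max) (auto simp: less_imp_neq[symmetric])
  then have g: "(g has_real_derivative c - r t) (at t)" if "t > 0" for t
    unfolding g_def using that by (rule primitive_has_derivative)
  then have cg: "continuous_on {a..b} g"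
    using assms(5) by (intro continuous_at_imp_continuous_on ballI DERIV_isCont[OF g]) auto
  define v where "v y = 3 * sin (pi * y) - (sin (pi * y))\<^sup>2" for y :: real
  define v' where "v' y = pi * (3 * cos (pi * y) - 2 * sin (pi * y) * cos (pi * y))" for y :: real
  define v'' where "v'' y = - (pi\<^sup>2) * (2 + 3 * sin (pi * y) - 4 * (sin (pi * y))\<^sup>2)" for y :: real
  have v: "(v has_real_derivative v' y) (at y)" for y
    unfolding v_def v'_def by (rule derivative_eq_intros refl | simp add: algebra_simps)+
  have v': "(v' has_real_derivative v'' y) (at y)" for y
    unfolding v'_def v''_def
    by (rule derivative_eq_intros refl | simp)+
      (simp add: cos_squared_eq power2_eq_square[symmetric] algebra_simps,
       simp add: power2_eq_square algebra_simps)
  have cv: "continuous_on UNIV v" unfolding v_def by (intro continuous_intros)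
  have sin01: "0 \<le> sin (pi * (x / L t)) \<and> sin (pi * (x / L t)) \<le> 1"
    if "0 \<le> x" "x \<le> L t" "t > 0" for x t
    using sin_pi_times_nonneg[of "x / L t"] that L(1)[of t] by simp
  have v0: "0 \<le> v (x / L t) \<and> v'' (x / L t) \<le> - (pi\<^sup>2)" if "0 \<le> x" "x \<le> L t" "t > 0" for x t
  proof -
    define S where "S = sin (pi * (x / L t))"
    have S: "0 \<le> S" "S \<le> 1" using sin01[OF that] by (auto simp: S_def)
    have "0 \<le> S * (3 - S)" using S by simp
    moreover have "0 \<le> (1 - S) * (1 + 4 * S)" using S by simp
    then have "1 \<le> 2 + 3 * S - 4 * S\<^sup>2" by (simp add: power2_eq_square algebra_simps)
    then have "pi\<^sup>2 * 1 \<le> pi\<^sup>2 * (2 + 3 * S - 4 * S\<^sup>2)" by (intro mult_left_mono) auto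
    ultimately show ?thesis
      by (simp add: v_def v''_def S_def power2_eq_square algebra_simps)
  qed
  \<comment> \<open>a lower bound for \<open>u\<^sub>t - D u\<^sub>x\<^sub>x - c u\<close>, where \<open>u\<close> is the profile of \<open>v\<close>\<close>
  define e where "e x t = profile D L L' g (\<lambda>_. 1) x t * (D * pi\<^sup>2 / (L t)\<^sup>2)" for x t
  have compact: "compact (moving_region L a b)"
    using L(1,4) assms(5) by (intro compact_moving_region) (auto elim: continuous_on_subset)
  have "continuous_on (moving_region L a b) (\<lambda>p. L (snd p))"
    by (rule continuous_on_compose2[OF L(4)])
      (use assms(5) in \<open>auto simp: moving_region_def intro: continuous_intros\<close>)
  moreover have "continuous_on (moving_region L a b) (\<lambda>p. profile D L L' g (\<lambda>_. 1) (fst p) (snd p))"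
    using continuous_on_profile[OF assms(1,3) _ cg, of "\<lambda>_. 1"] assms(5)
    by (simp add: case_prod_beta)
  ultimately have "continuous_on (moving_region L a b) (\<lambda>p. e (fst p) (snd p))"
    unfolding e_def using L(1) assms(5)
    by (intro continuous_intros) (auto simp: moving_region_def less_imp_neq[symmetric])
  moreover have "(0, a) \<in> moving_region L a b"
    using L(1)[of a] assms(5) by (auto simp: moving_region_def b_def)
  ultimately obtain p where p: "p \<in> moving_region L a b"
      "\<And>q. q \<in> moving_region L a b \<Longrightarrow> e (fst p) (snd p) \<le> e (fst q) (snd q)"
    using continuous_attains_inf[OF compact, of "\<lambda>p. e (fst p) (snd p)"] by blast
  define m where "m = e (fst p) (snd p)"
  have "m > 0"
    using p(1) L(1)[of "snd p"] assms(1,5) by (auto simp: m_def e_def profile_def moving_region_def)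
  have m: "m \<le> e x t" if "a \<le> t" "t \<le> b" "0 \<le> x" "x \<le> L t" for x t
    using p(2)[of "(x, t)"] that by (simp add: m_def moving_region_def)
  have "continuous_on {(x, t). t > 0 \<and> 0 \<le> x \<and> x \<le> L t} (\<lambda>(x, t). \<psi> x t)"
    using assms(4) by (simp add: nonneg_solution_def)
  then have "continuous_on {0..L a} (\<lambda>x. (\<lambda>(x, t). \<psi> x t) (x, a))"
    by (rule continuous_on_compose2) (use assms(5) in \<open>auto intro!: continuous_intros\<close>)
  then obtain x0 where x0: "x0 \<in> {0..L a}" "\<And>x. x \<in> {0..L a} \<Longrightarrow> \<psi> x a \<le> \<psi> x0 a"
    using continuous_attains_sup[of "{0..L a}" "\<lambda>x. \<psi> x a"] L(1)[of a] assms(5) by auto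
  define M where "M = \<psi> x0 a"
  have "M \<ge> 0" using x0(1) assms(4,5) by (auto simp: M_def nonneg_solution_def)
  \<comment> \<open>chosen so that \<open>K * m\<close> outweighs \<open>M * exp (c * t)\<close>, which differentiating \<open>b - t\<close> produces\<close>
  define K where "K = M * exp (c * b) / m"
  have "K \<ge> 0" using \<open>M \<ge> 0\<close> \<open>m > 0\<close> by (simp add: K_def)
  define h where "h x t = K * profile D L L' g v x t + M * exp (c * t) * (b - t)" for x t
  have prof0: "0 \<le> profile D L L' g v x t" if "0 \<le> x" "x \<le> L t" "t > 0" for x t
    using v0[OF that] by (simp add: profile_def)
  have super: "linear_supersolution D c L a b h"
    unfolding linear_supersolution_def
  proof
    have "continuous_on (moving_region L a b) (\<lambda>p. profile D L L' g v (fst p) (snd p))"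
      using continuous_on_profile[OF assms(1,3) _ cg cv] assms(5) by (simp add: case_prod_beta)
    then show "continuous_on (moving_region L a b) (\<lambda>(x, t). h x t)"
      unfolding h_def case_prod_beta by (intro continuous_intros)
    obtain p\<^sub>x p\<^sub>x\<^sub>x p\<^sub>t where pd: "\<forall>t>0. \<forall>x.
     ((\<lambda>y. profile D L L' g v y t) has_real_derivative p\<^sub>x x t) (at x) \<and>
     ((\<lambda>y. p\<^sub>x y t) has_real_derivative p\<^sub>x\<^sub>x x t) (at x) \<and>
     ((\<lambda>s. profile D L L' g v x s) has_real_derivative p\<^sub>t x t) (at t) \<and>
     p\<^sub>t x t - D * p\<^sub>x\<^sub>x x t = exp (g t - L' t * x\<^sup>2 / (4 * D * L t)) *
       ((c - r t + L' t / (2 * L t) - L'' t * x\<^sup>2 / (4 * D * L t)) * v (x / L t)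
         - D * v'' (x / L t) / (L t)\<^sup>2)"
      using profile_parabolic_residual[OF assms(1,3) v v' g] by blast
    show "\<exists>h\<^sub>x h\<^sub>x\<^sub>x h\<^sub>t. \<forall>t x. a < t \<longrightarrow> t \<le> b \<longrightarrow> 0 < x \<longrightarrow> x < L t \<longrightarrow>
        ((\<lambda>y. h y t) has_real_derivative h\<^sub>x x t) (at x) \<and>
        ((\<lambda>y. h\<^sub>x y t) has_real_derivative h\<^sub>x\<^sub>x x t) (at x) \<and>
        ((\<lambda>s. h x s) has_real_derivative h\<^sub>t x t) (at t) \<and>
        h\<^sub>t x t \<ge> D * h\<^sub>x\<^sub>x x t + c * h x t"
    proof (intro exI allI impI conjI)
      fix t x assume *: "a < t" "t \<le> b" "0 < x" "x < L t"
      then have "t > 0" using assms(5) by simp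
      then have d: "((\<lambda>y. profile D L L' g v y t) has_real_derivative p\<^sub>x x t) (at x)"
          "((\<lambda>y. p\<^sub>x y t) has_real_derivative p\<^sub>x\<^sub>x x t) (at x)"
          "((\<lambda>s. profile D L L' g v x s) has_real_derivative p\<^sub>t x t) (at t)"
          "p\<^sub>t x t - D * p\<^sub>x\<^sub>x x t = exp (g t - L' t * x\<^sup>2 / (4 * D * L t)) *
            ((c - r t + L' t / (2 * L t) - L'' t * x\<^sup>2 / (4 * D * L t)) * v (x / L t)
              - D * v'' (x / L t) / (L t)\<^sup>2)"
        using pd by blast+
      show "((\<lambda>y. h y t) has_real_derivative (\<lambda>x t. K * p\<^sub>x x t) x t) (at x)"
        unfolding h_def by (rule derivative_eq_intros d(1) refl)+ simp
      show "((\<lambda>y. (\<lambda>x t. K * p\<^sub>x x t) y t) has_real_derivative (\<lambda>x t. K * p\<^sub>x\<^sub>x x t) x t) (at x)"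
        by (rule DERIV_cmult[OF d(2)])
      show "((\<lambda>s. h x s) has_real_derivative
        (\<lambda>x t. K * p\<^sub>t x t + M * exp (c * t) * (c * (b - t) - 1)) x t) (at t)"
        unfolding h_def by (rule derivative_eq_intros d(3) refl)+ (simp add: algebra_simps)
      let ?E = "exp (g t - L' t * x\<^sup>2 / (4 * D * L t))"
      have "c \<le> c - r t + L' t / (2 * L t) - L'' t * x\<^sup>2 / (4 * D * L t)"
        using growth_term_bound[of D x "L t" "L'' t"] * assms(1) by (simp add: r_def)
      then have "c * v (x / L t) \<le>
          (c - r t + L' t / (2 * L t) - L'' t * x\<^sup>2 / (4 * D * L t)) * v (x / L t)"
        using v0[of x t] * \<open>t > 0\<close> by (intro mult_right_mono) auto
      moreover have "D * pi\<^sup>2 / (L t)\<^sup>2 \<le> - (D * v'' (x / L t) / (L t)\<^sup>2)"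
      proof -
        have "D * pi\<^sup>2 \<le> D * (- v'' (x / L t))"
          using v0[of x t] * \<open>t > 0\<close> assms(1) by (intro mult_left_mono) auto
        then have "D * pi\<^sup>2 / (L t)\<^sup>2 \<le> D * (- v'' (x / L t)) / (L t)\<^sup>2"
          by (rule divide_right_mono) simp
        then show ?thesis by simp
      qed
      ultimately have "?E * (c * v (x / L t) + D * pi\<^sup>2 / (L t)\<^sup>2) \<le> p\<^sub>t x t - D * p\<^sub>x\<^sub>x x t"
        unfolding d(4) by (intro mult_left_mono) auto
      then have "c * profile D L L' g v x t + e x t \<le> p\<^sub>t x t - D * p\<^sub>x\<^sub>x x t"
        by (simp add: profile_def e_def algebra_simps)
      with m[of t x] * have "c * profile D L L' g v x t + m \<le> p\<^sub>t x t - D * p\<^sub>x\<^sub>x x t" by simp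
      then have "K * (c * profile D L L' g v x t + m) \<le> K * (p\<^sub>t x t - D * p\<^sub>x\<^sub>x x t)"
        using \<open>K \<ge> 0\<close> by (rule mult_left_mono)
      moreover have "M * exp (c * t) \<le> M * exp (c * b)"
        using * \<open>c > 0\<close> \<open>M \<ge> 0\<close> by (intro mult_left_mono) auto
      then have "M * exp (c * t) \<le> K * m" using \<open>m > 0\<close> by (simp add: K_def)
      ultimately show "(\<lambda>x t. K * p\<^sub>t x t + M * exp (c * t) * (c * (b - t) - 1)) x t
          \<ge> D * (\<lambda>x t. K * p\<^sub>x\<^sub>x x t) x t + c * h x t"
        by (simp add: h_def algebra_simps)
    qed
  qed
  have "\<psi> x b \<le> 3 * K * exp (g b) * profile D L L' (\<lambda>_. 0) (\<lambda>y. sin (pi * y)) x b"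
    if "x \<in> {0..L b}" for x
  proof -
    have "b > 0" using assms(5) by (simp add: b_def)
    have "\<psi> x b \<le> h x b"
    proof (rule comparison_principle[OF assms(1-4) super assms(5)])
      fix y assume y: "0 \<le> y" "y \<le> L a"
      have "\<psi> y a \<le> M * 1" using x0(2) y by (simp add: M_def)
      also have "\<dots> \<le> M * exp (c * a)"
        using \<open>c > 0\<close> \<open>M \<ge> 0\<close> assms(5) by (intro mult_left_mono) auto
      also have "\<dots> \<le> h y a"
        using prof0[of y a] y assms(5) \<open>K \<ge> 0\<close> by (simp add: h_def b_def)
      finally show "\<psi> y a \<le> h y a" .
    next
      fix t assume t: "t \<in> {a..b}"
      then have "t > 0" using assms(5) by simp
      then show "0 \<le> h 0 t \<and> 0 \<le> h (L t) t"
        using prof0[of 0 t] prof0[of "L t" t] L(1)[of t] \<open>K \<ge> 0\<close> \<open>M \<ge> 0\<close> t by (simp add: h_def)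
    qed (use that in \<open>auto simp: b_def\<close>)
    also have "h x b = K * profile D L L' g v x b" by (simp add: h_def)
    also have "\<dots> \<le> K * profile D L L' g (\<lambda>y. 3 * sin (pi * y)) x b"
      using \<open>K \<ge> 0\<close> by (intro mult_left_mono) (simp_all add: profile_def v_def)
    also have "\<dots> = 3 * K * exp (g b) * profile D L L' (\<lambda>_. 0) (\<lambda>y. sin (pi * y)) x b"
      by (simp add: profile_def exp_diff exp_minus field_simps)
    finally show ?thesis .
  qed
  then show ?thesis using \<open>K \<ge> 0\<close> by (intro exI[of _ "3 * K * exp (g b)"]) auto
qed

section \<open>Convergence to zero\<close>

theorem corollary4p1:
  fixes D f'0 :: real
    and f L L' L'' :: "real \<Rightarrow> real"
    and \<psi> :: "real \<Rightarrow> real \<Rightarrow> real"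
  assumes "D > 0"
    and "kpp_type f f'0"
    and "C2_length L L' L''"
    and "nonneg_solution D f L \<psi>"
    and "bdd_below ((\<lambda>t. L' t * L t) ` {0..})"
    and "filterlim (\<lambda>T. integral {0..T} (\<lambda>t.
           D * pi\<^sup>2 / (L t)\<^sup>2 - D * pi\<^sup>2 / (L_crit D f'0)\<^sup>2
           - L t * max 0 (L'' t) / (4 * D) + L' t / (2 * L t))) at_top at_top"
  shows "uniformly_to_zero L \<psi>"
proof -
  note L = C2_lengthD[OF assms(3)]
  have "f'0 > 0" using assms(2) by (simp add: kpp_type_def)
  define G where "G t = D * pi\<^sup>2 / (L t)\<^sup>2 - D * pi\<^sup>2 / (L_crit D f'0)\<^sup>2
           - L t * max 0 (L'' t) / (4 * D) + L' t / (2 * L t)" for t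
  have crit: "D * pi\<^sup>2 / (L_crit D f'0)\<^sup>2 = f'0"
    using assms(1) \<open>f'0 > 0\<close> by (simp add: L_crit_def power_mult_distrib)
  define g where "g T = - integral {0..T} G" for T
  have "continuous_on {0..} G"
    unfolding G_def crit using L(4-6) L(1) assms(1)
    by (intro continuous_intros continuous_on_max) (auto simp: less_imp_neq[symmetric])
  then have g: "(g has_real_derivative - G t) (at t)" if "t > 0" for t
    unfolding g_def using that by (intro DERIV_minus primitive_has_derivative)
  have g_bot: "filterlim g at_bot at_top"
    using assms(6) unfolding g_def G_def by (subst filterlim_uminus_at_bot) simp
  define v where "v y = sin (pi * y)" for y :: real
  define v' where "v' y = pi * cos (pi * y)" for y :: real
  define v'' where "v'' y = - (pi\<^sup>2) * sin (pi * y)" for y :: real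
  have v: "(v has_real_derivative v' y) (at y)" "(v' has_real_derivative v'' y) (at y)" for y
    unfolding v_def v'_def v''_def
    by (rule derivative_eq_intros refl | simp add: power2_eq_square)+
  have cv: "continuous_on UNIV v" unfolding v_def by (intro continuous_intros)
  have v01: "0 \<le> v (x / L t)" "v (x / L t) \<le> 1" if "0 \<le> x" "x \<le> L t" "t > 0" for x t
    using sin_pi_times_nonneg[of "x / L t"] that L(1)[of t] by (simp_all add: v_def)
  obtain K where K: "K \<ge> 0"
      "\<And>x. x \<in> {0..L 2} \<Longrightarrow> \<psi> x 2 \<le> K * profile D L L' (\<lambda>_. 0) v x 2"
    using solution_le_sine[OF assms(1-4), of 1] unfolding v_def[symmetric] by auto
  \<comment> \<open>\<open>K\<close> refers to zero amplitude; the factor turns it into the amplitude \<open>exp (g t)\<close> at time 2\<close>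
  define A where "A = K * exp (- g 2)"
  have "A \<ge> 0" using K(1) by (simp add: A_def)
  define h where "h x t = A * profile D L L' g v x t" for x t
  have super: "linear_supersolution D f'0 L 2 T h" for T
    unfolding linear_supersolution_def
  proof
    have "continuous_on {2..T} g"
      by (intro continuous_at_imp_continuous_on ballI DERIV_isCont[OF g]) auto
    from continuous_on_profile[OF assms(1,3) _ this cv]
    show "continuous_on (moving_region L 2 T) (\<lambda>(x, t). h x t)"
      unfolding h_def case_prod_beta by (intro continuous_intros) simp
    obtain p\<^sub>x p\<^sub>x\<^sub>x p\<^sub>t where pd: "\<forall>t>0. \<forall>x.
     ((\<lambda>y. profile D L L' g v y t) has_real_derivative p\<^sub>x x t) (at x) \<and>
     ((\<lambda>y. p\<^sub>x y t) has_real_derivative p\<^sub>x\<^sub>x x t) (at x) \<and>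
     ((\<lambda>s. profile D L L' g v x s) has_real_derivative p\<^sub>t x t) (at t) \<and>
     p\<^sub>t x t - D * p\<^sub>x\<^sub>x x t = exp (g t - L' t * x\<^sup>2 / (4 * D * L t)) *
       ((- G t + L' t / (2 * L t) - L'' t * x\<^sup>2 / (4 * D * L t)) * v (x / L t)
         - D * v'' (x / L t) / (L t)\<^sup>2)"
      using profile_parabolic_residual[OF assms(1,3) v g] by blast
    show "\<exists>h\<^sub>x h\<^sub>x\<^sub>x h\<^sub>t. \<forall>t x. 2 < t \<longrightarrow> t \<le> T \<longrightarrow> 0 < x \<longrightarrow> x < L t \<longrightarrow>
        ((\<lambda>y. h y t) has_real_derivative h\<^sub>x x t) (at x) \<and>
        ((\<lambda>y. h\<^sub>x y t) has_real_derivative h\<^sub>x\<^sub>x x t) (at x) \<and>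
        ((\<lambda>s. h x s) has_real_derivative h\<^sub>t x t) (at t) \<and>
        h\<^sub>t x t \<ge> D * h\<^sub>x\<^sub>x x t + f'0 * h x t"
    proof (intro exI allI impI conjI)
      fix t x assume *: "2 < t" "t \<le> T" "0 < x" "x < L t"
      then have "t > 0" by simp
      then have d: "((\<lambda>y. profile D L L' g v y t) has_real_derivative p\<^sub>x x t) (at x)"
          "((\<lambda>y. p\<^sub>x y t) has_real_derivative p\<^sub>x\<^sub>x x t) (at x)"
          "((\<lambda>s. profile D L L' g v x s) has_real_derivative p\<^sub>t x t) (at t)"
          "p\<^sub>t x t - D * p\<^sub>x\<^sub>x x t = exp (g t - L' t * x\<^sup>2 / (4 * D * L t)) *
            ((- G t + L' t / (2 * L t) - L'' t * x\<^sup>2 / (4 * D * L t)) * v (x / L t)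
              - D * v'' (x / L t) / (L t)\<^sup>2)"
        using pd by blast+
      show "((\<lambda>y. h y t) has_real_derivative (\<lambda>x t. A * p\<^sub>x x t) x t) (at x)"
        unfolding h_def by (rule DERIV_cmult[OF d(1)])
      show "((\<lambda>y. (\<lambda>x t. A * p\<^sub>x x t) y t) has_real_derivative (\<lambda>x t. A * p\<^sub>x\<^sub>x x t) x t) (at x)"
        by (rule DERIV_cmult[OF d(2)])
      show "((\<lambda>s. h x s) has_real_derivative (\<lambda>x t. A * p\<^sub>t x t) x t) (at t)"
        unfolding h_def by (rule DERIV_cmult[OF d(3)])
      let ?E = "exp (g t - L' t * x\<^sup>2 / (4 * D * L t))"
      have "f'0 \<le> - G t + L' t / (2 * L t) - L'' t * x\<^sup>2 / (4 * D * L t) + D * pi\<^sup>2 / (L t)\<^sup>2"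
        using growth_term_bound[of D x "L t" "L'' t"] * assms(1) by (simp add: G_def crit)
      then have "f'0 * v (x / L t) \<le> (- G t + L' t / (2 * L t)
          - L'' t * x\<^sup>2 / (4 * D * L t) + D * pi\<^sup>2 / (L t)\<^sup>2) * v (x / L t)"
        using v01[of x t] * \<open>t > 0\<close> by (intro mult_right_mono) auto
      also have "\<dots> = (- G t + L' t / (2 * L t) - L'' t * x\<^sup>2 / (4 * D * L t)) * v (x / L t)
              - D * v'' (x / L t) / (L t)\<^sup>2"
        by (simp add: v_def v''_def algebra_simps)
      finally have "?E * (f'0 * v (x / L t)) \<le> p\<^sub>t x t - D * p\<^sub>x\<^sub>x x t"
        unfolding d(4) by (intro mult_left_mono) auto
      then have "A * (f'0 * profile D L L' g v x t) \<le> A * (p\<^sub>t x t - D * p\<^sub>x\<^sub>x x t)"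
        using \<open>A \<ge> 0\<close> by (intro mult_left_mono) (simp_all add: profile_def algebra_simps)
      then show "(\<lambda>x t. A * p\<^sub>t x t) x t
          \<ge> D * (\<lambda>x t. A * p\<^sub>x\<^sub>x x t) x t + f'0 * h x t"
        by (simp add: h_def algebra_simps)
    qed
  qed
  have le_h: "\<psi> x t \<le> h x t" if "t \<ge> 2" "x \<in> {0..L t}" for x t
  proof (rule comparison_principle[OF assms(1-4) super[of t]])
    fix y assume y: "0 \<le> y" "y \<le> L 2"
    have "\<psi> y 2 \<le> K * profile D L L' (\<lambda>_. 0) v y 2" using K(2) y by simp
    also have "\<dots> = h y 2"
      by (simp add: h_def A_def profile_def exp_diff exp_minus field_simps)
    finally show "\<psi> y 2 \<le> h y 2" .
  next
    fix s assume "s \<in> {2..t}"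
    then show "0 \<le> h 0 s \<and> 0 \<le> h (L s) s"
      using L(1)[of s] by (simp add: h_def profile_def v_def)
  qed (use that in auto)
  obtain B where B: "\<And>t. t \<ge> 0 \<Longrightarrow> B \<le> L' t * L t"
    using assms(5) by (auto simp: bdd_below_def)
  define C where "C = \<bar>B\<bar> / (4 * D)"
  have prof: "profile D L L' g v x t \<le> exp (g t + C)" if "t > 0" "x \<in> {0..L t}" for x t
  proof -
    have Lt: "L t > 0" using L(1)[of t] that by simp
    have "(x / L t)\<^sup>2 \<le> 1" using that Lt by (intro power_le_one) auto
    moreover have "- (L' t * L t) \<le> \<bar>B\<bar>" using B[of t] that by simp
    ultimately have "- (L' t * L t) * (x / L t)\<^sup>2 \<le> \<bar>B\<bar> * 1"
      by (intro mult_mono) auto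
    then have "- (L' t * L t) * (x / L t)\<^sup>2 / (4 * D) \<le> C"
      unfolding C_def using assms(1) by (intro divide_right_mono) auto
    moreover have "- (L' t * L t) * (x / L t)\<^sup>2 / (4 * D) = - (L' t * x\<^sup>2 / (4 * D * L t))"
      using Lt assms(1) by (simp add: field_simps power2_eq_square)
    ultimately have "exp (g t - L' t * x\<^sup>2 / (4 * D * L t)) * v (x / L t) \<le> exp (g t + C) * 1"
      using v01[of x t] that by (intro mult_mono) auto
    then show ?thesis by (simp add: profile_def)
  qed
  have "((\<lambda>t. A * (exp (g t) * exp C)) \<longlongrightarrow> A * (0 * exp C)) at_top"
    by (intro tendsto_intros filterlim_compose[OF exp_at_bot g_bot])
  then have lim: "((\<lambda>t. A * exp (g t + C)) \<longlongrightarrow> 0) at_top" by (simp add: exp_add)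
  show ?thesis
    unfolding uniformly_to_zero_def
  proof (intro allI impI)
    fix \<epsilon> :: real assume "\<epsilon> > 0"
    with lim have "\<forall>\<^sub>F t in at_top. A * exp (g t + C) < \<epsilon>" by (rule order_tendstoD)
    moreover have "\<forall>\<^sub>F t :: real in at_top. t \<ge> 2" by (rule eventually_ge_at_top)
    ultimately show "\<forall>\<^sub>F t in at_top. \<forall>x\<in>{0..L t}. \<bar>\<psi> x t\<bar> < \<epsilon>"
    proof eventually_elim
      case (elim t)
      show ?case
      proof
        fix x assume x: "x \<in> {0..L t}"
        have "\<psi> x t \<ge> 0" using assms(4) x elim by (auto simp: nonneg_solution_def)
        moreover have "h x t \<le> A * exp (g t + C)"
          unfolding h_def using \<open>A \<ge> 0\<close> elim x by (intro mult_left_mono prof) auto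
        ultimately show "\<bar>\<psi> x t\<bar> < \<epsilon>" using le_h[of t x] elim x by simp
      qed
    qed
  qed
qed

end
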